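(* Let $A$ be a unital $C^*$-algebra and let $V=l_2(A)$ be the standard countably generated Hilbert $A$-module. Suppose that the topologies $\tau_{\widehat V}$ and $\tau_{V'}$ coincide on $V$. Then $V$ is self-dual and $A$ is finite-dimensional.
   Context: Hilbert modules are right Hilbert $C^*$-modules, with $A$-valued inner product $\langle\cdot,\cdot\rangle$ that is $A$-linear in the second variable and norm $\|x\|=\|\langle x,x\rangle\|^{1/2}$. The standard module $l_2(A)$ consists of all sequences $(a_i)_{i\in\mathbb N}$ in $A$ such that $\sum_{i=1}^\infty a_i^*a_i$ converges in norm, with inner product $\langle (a_i),(b_i)\rangle=\sum_i a_i^*b_i$. For a Hilbert $A$-module $V$, $V'$ denotes the set of all bounded $A$-linear maps $V\to A$. $V$ is called self-dual if every $f\in V'$ is of the form $f=\langle x,\cdot\rangle$ for some $x\in V$. The topology $\tau_{V'}$ on $V$ is the locally convex topology generated by the seminorms $\nu_f(x)=\|f(x)\|$, $f\in V'$; the topology $\tau_{\widehat V}$ on $V$ is the locally convex topology generated by the seminorms $\mu_z(x)=\|\langle z,x\rangle\|$, $z\in V$. *)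

theory Defs
  imports "HOL-Analysis.Analysis" "HOL-Library.Function_Algebras"
begin

text \<open>The real scalar multiplication and the norm come from \<^class>\<open>real_normed_algebra\<close>,
  whose axioms include submultiplicativity of the norm.\<close>

class cstar_algebra = real_normed_algebra + banach +
  fixes scaleC :: "complex \<Rightarrow> 'a \<Rightarrow> 'a"  (infixr "*\<^sub>C" 75)
    and adj :: "'a \<Rightarrow> 'a"
  assumes scaleC_add_right: "c *\<^sub>C (x + y) = c *\<^sub>C x + c *\<^sub>C y"
    and scaleC_add_left: "(c + d) *\<^sub>C x = c *\<^sub>C x + d *\<^sub>C x"
    and scaleC_scaleC: "c *\<^sub>C d *\<^sub>C x = (c * d) *\<^sub>C x"
    and scaleR_scaleC: "scaleR r x = complex_of_real r *\<^sub>C x"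
    and scaleC_mult_left: "(c *\<^sub>C x) * y = c *\<^sub>C (x * y)"
    and scaleC_mult_right: "x * (c *\<^sub>C y) = c *\<^sub>C (x * y)"
    and norm_scaleC: "norm (c *\<^sub>C x) = cmod c * norm x"
    and adj_adj: "adj (adj x) = x"
    and adj_add: "adj (x + y) = adj x + adj y"
    and adj_scaleC: "adj (c *\<^sub>C x) = cnj c *\<^sub>C adj x"
    and adj_mult: "adj (x * y) = adj y * adj x"
    and cstar_identity: "norm (adj x * x) = (norm x)\<^sup>2"

text \<open>\<^class>\<open>monoid_mult\<close> is used instead of \<^class>\<open>real_normed_algebra_1\<close> so that the
  zero algebra, where \<open>1 = 0\<close>, is not excluded.\<close>

class unital_cstar_algebra = cstar_algebra + monoid_mult

lemma vector_space_scaleC: "vector_space (scaleC :: complex \<Rightarrow> 'a::cstar_algebra \<Rightarrow> 'a)"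
proof
  show "1 *\<^sub>C x = x" for x :: 'a
    using scaleR_scaleC[of 1 x] by simp
qed (simp_all add: scaleC_add_right scaleC_add_left scaleC_scaleC)

definition finite_dim_over_complex :: "'a::cstar_algebra itself \<Rightarrow> bool"
  where "finite_dim_over_complex _ \<longleftrightarrow>
    (\<exists>B. finite_dimensional_vector_space (scaleC :: complex \<Rightarrow> 'a \<Rightarrow> 'a) B)"

instantiation complex :: unital_cstar_algebra
begin

definition scaleC_complex :: "complex \<Rightarrow> complex \<Rightarrow> complex"
  where "scaleC_complex c z = c * z"

definition adj_complex :: "complex \<Rightarrow> complex"
  where "adj_complex z = cnj z"

instance
  by standard
    (simp_all add: scaleC_complex_def adj_complex_def scaleR_conv_of_real algebra_simps
      norm_mult power2_eq_square)

end

text \<open>The data of a right Hilbert module with carrier \<open>mcarrier V\<close> inside a type \<open>'v\<close> that supplies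
  the addition. The definitions below are meant for \<open>V\<close> closed under the operations.\<close>

record ('v, 'a) hmodule =
  mcarrier :: "'v set"
  maction :: "'v \<Rightarrow> 'a \<Rightarrow> 'v"
  minner :: "'v \<Rightarrow> 'v \<Rightarrow> 'a"

definition mnorm :: "('v, 'a::cstar_algebra) hmodule \<Rightarrow> 'v \<Rightarrow> real"
  where "mnorm V x = sqrt (norm (minner V x x))"

text \<open>Elements of \<open>V'\<close> are represented by functions on \<open>'v\<close>; their values outside the carrier
  are irrelevant. Over a unital algebra, additivity and \<open>A\<close>-homogeneity imply complex linearity.\<close>

definition mdual :: "('v::ab_group_add, 'a::cstar_algebra) hmodule \<Rightarrow> ('v \<Rightarrow> 'a) set"
  where "mdual V = {f.
    (\<forall>x\<in>mcarrier V. \<forall>y\<in>mcarrier V. f (x + y) = f x + f y) \<and>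
    (\<forall>x\<in>mcarrier V. \<forall>a. f (maction V x a) = f x * a) \<and>
    (\<exists>C. \<forall>x\<in>mcarrier V. norm (f x) \<le> C * mnorm V x)}"

definition self_dual :: "('v::ab_group_add, 'a::cstar_algebra) hmodule \<Rightarrow> bool"
  where "self_dual V \<longleftrightarrow>
    (\<forall>f\<in>mdual V. \<exists>x\<in>mcarrier V. \<forall>y\<in>mcarrier V. f y = minner V x y)"

text \<open>The open balls of the single seminorms, around all points, form a subbase of the locally
  convex topology. Inserting \<open>S\<close> makes \<open>S\<close> the underlying space even if \<open>P\<close> is empty.\<close>

definition seminorm_topology :: "'v::ab_group_add set \<Rightarrow> ('v \<Rightarrow> real) set \<Rightarrow> 'v topology"
  where "seminorm_topology S P = topology_generated_by
    (insert S {{y \<in> S. p (y - x) < e} | p x e. p \<in> P \<and> x \<in> S \<and> e > 0})"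

definition dual_topology :: "('v::ab_group_add, 'a::cstar_algebra) hmodule \<Rightarrow> 'v topology"
  where "dual_topology V = seminorm_topology (mcarrier V) {\<lambda>x. norm (f x) | f. f \<in> mdual V}"

definition hat_topology :: "('v::ab_group_add, 'a::cstar_algebra) hmodule \<Rightarrow> 'v topology"
  where "hat_topology V =
    seminorm_topology (mcarrier V) {\<lambda>x. norm (minner V z x) | z. z \<in> mcarrier V}"

text \<open>Addition of sequences is pointwise, from \<^theory>\<open>HOL-Library.Function_Algebras\<close>.\<close>

definition l2 :: "(nat \<Rightarrow> 'a, 'a::cstar_algebra) hmodule"
  where "l2 = \<lparr>
    mcarrier = {x. summable (\<lambda>i. adj (x i) * x i)},
    maction = (\<lambda>x a i. x i * a),
    minner = (\<lambda>x y. \<Sum>i. adj (x i) * y i)\<rparr>"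

end

theory Submission
  imports Defs
begin

text \<open>If every functional of \<^term>\<open>mdual l2\<close> is continuous for the hat topology, it is controlled near
  \<open>0\<close> by finitely many seminorms \<open>\<parallel>\<langle>z, \<cdot>\<rangle>\<parallel>\<close>, and the coordinates of each such \<open>z\<close> tend to \<open>0\<close>; hence the
  coefficients of the functional tend to \<open>0\<close>. Every sequence \<open>a\<close> for which the sums \<open>\<Sum>i<n. a\<^sub>i a\<^sub>i\<^sup>*\<close> are
  bounded is the coefficient sequence of a functional, so \<open>a\<^sub>i \<rightarrow> 0\<close>; applied to square roots of blocks,
  this says that bounded increasing sequences in \<open>A\<close> converge in norm. Self-duality follows
  because the coefficients of any functional have bounded sums \<open>\<Sum>i<n. a\<^sub>i a\<^sub>i\<^sup>*\<close>. For finite dimension,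
  the limits of the powers of a positive element of norm \<open>1\<close> are projections, and strictly
  decreasing sequences of projections are finite. So \<open>1\<close> is a sum of minimal projections
  \<open>p\<^sub>1, \<dots>, p\<^sub>n\<close>, and each \<open>p\<^sub>i A p\<^sub>j\<close> is at most one-dimensional.

  Positivity is handled without spectra: square roots come from the binomial series, and norm
  estimates from the fact that \<open>k + \<i> l\<close> is a multiple of a unitary when \<open>k\<close>, \<open>l\<close> are commuting selfadjoint
  elements with \<open>k\<^sup>2 + l\<^sup>2\<close> scalar.\<close>

section \<open>The involution\<close>

lemma adj_zero [simp]: "adj (0::'a::cstar_algebra) = 0"
  using adj_add[of "0::'a" 0] by simp

lemma adj_minus [simp]: "adj (- x) = - adj (x::'a::cstar_algebra)"
  using adj_add[of x "- x"] by (simp add: eq_neg_iff_add_eq_0 add.commute)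

lemma adj_diff: "adj (x - y) = adj x - adj (y::'a::cstar_algebra)"
  using adj_add[of x "- y"] by simp

lemma adj_scaleR: "adj (r *\<^sub>R x) = r *\<^sub>R adj (x::'a::cstar_algebra)"
  by (simp add: scaleR_scaleC adj_scaleC)

lemma adj_sum: "adj (sum f F) = (\<Sum>i\<in>F. adj (f i :: 'a::cstar_algebra))"
  by (induction F rule: infinite_finite_induct) (auto simp: adj_add)

lemma adj_one [simp]: "adj (1::'a::unital_cstar_algebra) = 1"
  by (metis adj_adj adj_mult mult_1_right)

lemma norm_adj [simp]: "norm (adj x) = norm (x::'a::cstar_algebra)"
proof -
  have *: "norm y \<le> norm (adj y)" for y :: 'a
  proof (cases "y = 0")
    case False
    have "norm y * norm y \<le> norm (adj y) * norm y"
      using norm_mult_ineq[of "adj y" y] by (simp add: cstar_identity power2_eq_square)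
    then show ?thesis using False by simp
  qed simp
  show ?thesis using *[of x] *[of "adj x"] by (simp add: adj_adj)
qed

lemma norm_mult_adj: "norm (x * adj x) = (norm (x::'a::cstar_algebra))\<^sup>2"
  using cstar_identity[of "adj x"] by (simp add: adj_adj)

lemma norm_square_selfadjoint:
  "adj h = h \<Longrightarrow> norm (h * h) = (norm (h::'a::cstar_algebra))\<^sup>2"
  using cstar_identity[of h] by simp

lemma bounded_linear_adj: "bounded_linear (adj :: 'a::cstar_algebra \<Rightarrow> 'a)"
  by (rule bounded_linear_intro[where K = 1]) (simp_all add: adj_add adj_scaleR)

text \<open>Only an inequality, because \<open>1\<close> has norm \<open>0\<close> in the zero
  algebra.\<close>

lemma norm_one_le: "norm (1::'a::unital_cstar_algebra) \<le> 1"
  using norm_square_selfadjoint[of "1::'a"] by (auto simp: power2_eq_square)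

lemma norm_scaleR_one_le: "0 \<le> s \<Longrightarrow> norm (s *\<^sub>R (1::'a::unital_cstar_algebra)) \<le> s"
  using norm_one_le[where 'a='a] mult_left_le by auto

lemma norm_power_le: "norm (x ^ n) \<le> (norm (x::'a::unital_cstar_algebra)) ^ n"
proof (induction n)
  case 0 then show ?case by (simp add: norm_one_le)
next
  case (Suc n) then show ?case
    by (simp, meson mult_left_mono norm_ge_zero norm_mult_ineq order_trans)
qed

lemma adj_power: "adj (x ^ n) = (adj (x::'a::unital_cstar_algebra)) ^ n"
  by (induction n) (simp_all add: adj_mult power_commutes)

section \<open>Square roots and positive elements\<close>

text \<open>The power series of \<open>sqrt (1 - y)\<close>; as the coefficients after the first are nonpositive with
  absolute values summing to at most \<open>1\<close>, it converges on the closed unit ball.\<close>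

definition sqrt_coeff :: "nat \<Rightarrow> real"
  where "sqrt_coeff n = (- 1) ^ n * ((1/2) gchoose n)"

text \<open>Partial sums of coefficients correspond to division by \<open>1 - y\<close>, and
  \<open>sqrt (1 - y) / (1 - y)\<close> is the binomial series with exponent
  \<open>- 1/2\<close>.\<close>

lemma sum_sqrt_coeff: "(\<Sum>k\<le>n. sqrt_coeff k) = (- 1) ^ n * ((- 1/2) gchoose n)"
  using gbinomial_sum_lower_neg[of "1/2::real" n] by (simp add: sqrt_coeff_def mult.commute)

text \<open>Positivity here keeps the partial sums of \<open>sqrt_coeff\<close> above
  \<open>0\<close>; since the first coefficient is \<open>1\<close>, the later ones have total
  absolute value at most \<open>1\<close>.\<close>

lemma neg_half_gbinomial_pos: "0 < (- 1) ^ n * ((- 1/2 :: real) gchoose n)"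
proof (induction n)
  case (Suc n)
  have step: "(- 1/2 :: real) gchoose (Suc n) = ((-1/2) gchoose n) * (-1/2 - real n) / real (Suc n)"
    using gbinomial_mult_1[of "- 1/2 :: real" n] by (simp add: field_simps)
  have "(- 1) ^ Suc n * ((- 1/2 :: real) gchoose (Suc n))
    = ((- 1) ^ n * ((-1/2) gchoose n)) * ((1/2 + real n) / real (Suc n))"
    unfolding step by (simp add: field_simps)
  then show ?case using Suc by (simp only:) (simp add: zero_less_mult_iff zero_less_divide_iff)
qed simp

lemma sqrt_coeff_neg: "sqrt_coeff (Suc n) \<le> 0"
proof -
  have "sqrt_coeff (Suc n) = - ((- 1) ^ n * ((- 1/2) gchoose n)) / (2 * real (Suc n))"
    using gbinomial_absorption'[of "Suc n" "1/2::real"] by (simp add: sqrt_coeff_def field_simps)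
  moreover have "\<dots> \<le> 0"
    using neg_half_gbinomial_pos[of n] by (intro divide_nonpos_nonneg) linarith+
  ultimately show ?thesis by simp
qed

lemma sum_abs_sqrt_coeff_Suc: "(\<Sum>k<n. \<bar>sqrt_coeff (Suc k)\<bar>) \<le> 1"
proof -
  have "(\<Sum>k<n. \<bar>sqrt_coeff (Suc k)\<bar>) = - (\<Sum>k<n. sqrt_coeff (Suc k))"
    using sqrt_coeff_neg by (simp add: sum_negf)
  also have "\<dots> = 1 - (\<Sum>k<Suc n. sqrt_coeff k)"
    by (subst sum.lessThan_Suc_shift) (simp add: sqrt_coeff_def)
  also have "\<dots> \<le> 1"
    using sum_sqrt_coeff[of n] neg_half_gbinomial_pos[of n] by (simp add: lessThan_Suc_atMost)
  finally show ?thesis .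
qed

lemma summable_abs_sqrt_coeff: "summable (\<lambda>k. \<bar>sqrt_coeff k\<bar>)"
proof -
  have "summable (\<lambda>k. \<bar>sqrt_coeff (Suc k)\<bar>)"
    using sum_abs_sqrt_coeff_Suc by (intro bounded_imp_summable[where B = 1]) (auto simp flip: lessThan_Suc_atMost simp del: sum.lessThan_Suc)
  then show ?thesis by (subst (asm) summable_Suc_iff)
qed

text \<open>Vandermonde for \<open>1/2 + 1/2 = 1\<close>: the formal square of the series is
  \<open>1 - y\<close>.\<close>

lemma sqrt_coeff_convolution:
  "(\<Sum>i\<le>n. sqrt_coeff i * sqrt_coeff (n - i)) = (if n = 0 then 1 else if n = 1 then - 1 else 0)"
proof -
  have "(\<Sum>i\<le>n. sqrt_coeff i * sqrt_coeff (n - i))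
    = (- 1) ^ n * (\<Sum>i\<le>n. ((1/2) gchoose i) * ((1/2) gchoose (n - i)))"
    unfolding sum_distrib_left
    by (intro sum.cong refl) (simp add: sqrt_coeff_def flip: power_add)
  also have "(\<Sum>i\<le>n. ((1/2) gchoose i) * ((1/2) gchoose (n - i))) = ((1/2 + 1/2 :: real) gchoose n)"
    using gbinomial_Vandermonde[of "1/2::real" "1/2" n] by (simp add: atLeast0AtMost)
  also have "((1/2 + 1/2 :: real) gchoose n) = of_nat (1 choose n)"
    by (simp add: binomial_gbinomial)
  finally show ?thesis by (cases n; cases "n - 1") auto
qed

text \<open>The series is evaluated at \<open>y = 1 - h\<close>. The root is a limit of polynomials
  in \<open>h\<close>, hence commutes with whatever commutes with \<open>h\<close>; the bound on
  \<open>1 - k\<close> is what makes the root positive.\<close>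

lemma selfadjoint_sqrt_norm_le_1:
  fixes h :: "'a::unital_cstar_algebra"
  assumes sa: "adj h = h" and le: "norm (1 - h) \<le> 1"
  shows "\<exists>k. adj k = k \<and> k * k = h \<and> norm (1 - k) \<le> 1 \<and> (\<forall>c. c * h = h * c \<longrightarrow> c * k = k * c)"
proof -
  define y where "y = 1 - h"
  have y: "norm y \<le> 1" "adj y = y" using le sa by (auto simp: y_def adj_diff)
  have pow: "norm (y ^ n) \<le> 1" for n
    by (meson norm_ge_zero norm_power_le order_trans power_le_one y(1))
  define g where "g n = sqrt_coeff n *\<^sub>R y ^ n" for n
  have g_le: "norm (g n) \<le> \<bar>sqrt_coeff n\<bar>" for n
    using mult_left_mono[OF pow abs_ge_zero] by (simp add: g_def)
  have sng: "summable (\<lambda>n. norm (g n))"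
    by (rule summable_comparison_test'[OF summable_abs_sqrt_coeff]) (simp add: g_le)
  then have sg: "summable g" by (rule summable_norm_cancel)
  define k where "k = suminf g"
  have "(\<lambda>n. \<Sum>i\<le>n. g i * g (n - i)) sums (k * k)"
    unfolding k_def by (rule Cauchy_product_sums[OF sng sng])
  also have "(\<lambda>n. \<Sum>i\<le>n. g i * g (n - i)) = (\<lambda>n. if n = 0 then 1 else if n = 1 then - y else 0)"
  proof
    fix n
    have "(\<Sum>i\<le>n. g i * g (n - i)) = (\<Sum>i\<le>n. (sqrt_coeff i * sqrt_coeff (n - i)) *\<^sub>R y ^ n)"
      by (intro sum.cong refl) (simp add: g_def flip: power_add)
    also have "\<dots> = (if n = 0 then 1 else if n = 1 then - y else 0)"
      by (subst scaleR_left.sum[symmetric], subst sqrt_coeff_convolution) simp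
    finally show "(\<Sum>i\<le>n. g i * g (n - i)) = (if n = 0 then 1 else if n = 1 then - y else 0)" .
  qed
  finally have kk: "(\<lambda>n. if n = 0 then 1 else if n = 1 then - y else 0) sums (k * k)" .
  have "(\<lambda>n. if n = 0 then 1 else if n = 1 then - y else 0)
    sums (\<Sum>n\<in>{0,1::nat}. if n = 0 then 1 else if n = 1 then - y else 0)"
    by (rule sums_finite) auto
  then have "k * k = 1 - y" using kk by (auto dest: sums_unique2)
  then have "k * k = h" by (simp add: y_def)
  moreover have "adj k = k"
  proof -
    have "adj (g n) = g n" for n by (simp add: g_def adj_scaleR adj_power y)
    then show ?thesis
      unfolding k_def using bounded_linear.suminf[OF bounded_linear_adj sg] by simp
  qed
  moreover have "norm (1 - k) \<le> 1"
  proof -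
    have "k = g 0 + (\<Sum>n. g (Suc n))"
      using suminf_split_head[OF sg] by (simp add: k_def)
    then have "1 - k = - (\<Sum>n. g (Suc n))" by (simp add: g_def sqrt_coeff_def)
    moreover have ss: "summable (\<lambda>n. \<bar>sqrt_coeff (Suc n)\<bar>)"
      using summable_abs_sqrt_coeff by (subst summable_Suc_iff)
    moreover have "norm (\<Sum>n. g (Suc n)) \<le> (\<Sum>n. \<bar>sqrt_coeff (Suc n)\<bar>)"
      by (rule norm_suminf_le) (use g_le ss in auto)
    moreover have "(\<Sum>n. \<bar>sqrt_coeff (Suc n)\<bar>) \<le> 1"
      by (rule suminf_le_const) (use ss sum_abs_sqrt_coeff_Suc in auto)
    ultimately show ?thesis by simp
  qed
  moreover have "c * k = k * c" if "c * h = h * c" for c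
  proof -
    have "y * c = c * y" using that by (simp add: y_def algebra_simps)
    then have "y ^ n * c = c * y ^ n" for n by (rule power_commuting_commutes)
    then have "c * g n = g n * c" for n by (simp add: g_def)
    then show ?thesis unfolding k_def
      by (simp add: suminf_mult[OF sg, symmetric] suminf_mult2[OF sg])
  qed
  ultimately show ?thesis by blast
qed

text \<open>This form of positivity makes closure under addition immediate; the equivalence with being
  a square is proved in \<open>selfadjoint_sqrt\<close> and \<open>positive_square\<close>.\<close>

definition positive :: "'a::unital_cstar_algebra \<Rightarrow> bool"
  where "positive h \<longleftrightarrow> adj h = h \<and> (\<exists>t. norm (t *\<^sub>R 1 - h) \<le> t)"

lemma positive_selfadjoint: "positive h \<Longrightarrow> adj h = h"
  by (simp add: positive_def)

lemma positive_zero [simp]: "positive 0"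
  unfolding positive_def by (auto intro!: exI[of _ 0])

lemma positive_add: "positive (a + b)" if ab: "positive a" "positive b"
proof -
  obtain s t where st: "norm (s *\<^sub>R 1 - a) \<le> s" "norm (t *\<^sub>R 1 - b) \<le> t"
    using ab by (auto simp: positive_def)
  have "norm ((s + t) *\<^sub>R 1 - (a + b)) = norm ((s *\<^sub>R 1 - a) + (t *\<^sub>R 1 - b))"
    by (simp add: scaleR_left_distrib algebra_simps)
  also have "\<dots> \<le> norm (s *\<^sub>R 1 - a) + norm (t *\<^sub>R 1 - b)" by (rule norm_triangle_ineq)
  also have "\<dots> \<le> s + t" using st by simp
  finally show ?thesis using ab by (auto simp: positive_def adj_add)
qed

lemma positive_sum: "(\<And>i. i \<in> F \<Longrightarrow> positive (f i)) \<Longrightarrow> positive (sum f F)"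
  by (induction F rule: infinite_finite_induct) (auto intro: positive_add)

lemma positive_scaleR:
  assumes "positive a" "0 \<le> r"
  shows "positive (r *\<^sub>R a)"
proof -
  obtain t where t: "norm (t *\<^sub>R 1 - a) \<le> t" using assms by (auto simp: positive_def)
  have "norm ((r * t) *\<^sub>R 1 - r *\<^sub>R a) = r * norm (t *\<^sub>R 1 - a)"
    using assms by (metis norm_scaleR abs_of_nonneg scaleR_scaleR scaleR_right_diff_distrib)
  also have "\<dots> \<le> r * t" using t assms by (simp add: mult_left_mono)
  finally show ?thesis using assms by (auto simp: positive_def adj_scaleR)
qed

lemma selfadjoint_sqrt:
  fixes h :: "'a::unital_cstar_algebra"
  assumes sa: "adj h = h" and le: "norm (s *\<^sub>R 1 - h) \<le> s"
  shows "\<exists>k. positive k \<and> k * k = h \<and> (\<forall>c. c * h = h * c \<longrightarrow> c * k = k * c)"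
proof (cases "s = 0")
  case True then show ?thesis using le by (intro exI[of _ 0]) simp
next
  case False
  have s: "0 < s" using le False norm_ge_zero[of "s *\<^sub>R 1 - h"] by linarith
  have "norm (1 - (1/s) *\<^sub>R h) = (1/s) * norm (s *\<^sub>R 1 - h)"
  proof -
    have "1 - (1/s) *\<^sub>R h = (1/s) *\<^sub>R (s *\<^sub>R 1 - h)" using s by (simp add: scaleR_right_diff_distrib)
    then show ?thesis using s by simp
  qed
  also have "\<dots> \<le> 1" using le s by simp
  finally have "norm (1 - (1/s) *\<^sub>R h) \<le> 1" .
  moreover have "adj ((1/s) *\<^sub>R h) = (1/s) *\<^sub>R h" by (simp add: adj_scaleR sa)
  ultimately obtain k where k: "adj k = k" "k * k = (1/s) *\<^sub>R h" "norm (1 - k) \<le> 1"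
      "\<forall>c. c * ((1/s) *\<^sub>R h) = ((1/s) *\<^sub>R h) * c \<longrightarrow> c * k = k * c"
    using selfadjoint_sqrt_norm_le_1[of "(1/s) *\<^sub>R h"] by blast
  have "positive k" unfolding positive_def using k(1,3) by (metis scaleR_one)
  then have "positive (sqrt s *\<^sub>R k)" using s by (simp add: positive_scaleR)
  moreover have "(sqrt s *\<^sub>R k) * (sqrt s *\<^sub>R k) = h" using s k(2) by simp
  moreover have "c * (sqrt s *\<^sub>R k) = (sqrt s *\<^sub>R k) * c" if "c * h = h * c" for c
    using k(4) that by simp
  ultimately show ?thesis by blast
qed

lemma positive_sqrt:
  fixes h :: "'a::unital_cstar_algebra"
  assumes "positive h"
  obtains k where "positive k" "k * k = h" "\<And>c. c * h = h * c \<Longrightarrow> c * k = k * c"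
proof -
  obtain s where "adj h = h" "norm (s *\<^sub>R 1 - h) \<le> s"
    using assms by (auto simp: positive_def)
  from selfadjoint_sqrt[OF this] that show thesis by blast
qed

section \<open>Order and norm estimates for positive elements\<close>

lemma norm_square_le_if_sum_squares:
  fixes k l :: "'a::unital_cstar_algebra"
  assumes sa: "adj k = k" "adj l = l" and comm: "k * l = l * k"
    and sum: "k * k + l * l = s *\<^sub>R 1" and s: "0 \<le> s"
  shows "norm (k * k) \<le> s"
proof -
  \<comment> \<open>As \<open>k\<close> and \<open>l\<close> commute, the cross terms of
    \<open>adj u * u\<close> cancel and leave \<open>s *\<^sub>R 1\<close>. So \<open>norm u\<close>
    is at most \<open>sqrt s\<close>, and \<open>k\<close> is the real part of
    \<open>u\<close>.\<close>
  define u where "u = k + \<i> *\<^sub>C l"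
  have adju: "adj u = k + (- \<i>) *\<^sub>C l"
    by (simp add: u_def adj_add adj_scaleC sa)
  have i0: "(- \<i>) *\<^sub>C x + \<i> *\<^sub>C x = (0::'a)" for x
    using scaleC_add_left[of "- \<i>" \<i> x] scaleR_scaleC[of 0 x] by simp
  have m1: "((- \<i>) * \<i>) *\<^sub>C x = (x::'a)" "(\<i> * (- \<i>)) *\<^sub>C x = x" for x
    using scaleR_scaleC[of 1 x] by simp_all
  have "adj u * u = k * k + l * l"
  proof -
    have "adj u * u = k * k + l * l + ((- \<i>) *\<^sub>C (k * l) + \<i> *\<^sub>C (k * l))"
      unfolding adju unfolding u_def
      by (simp only: distrib_left distrib_right scaleC_add_right scaleC_mult_left scaleC_mult_right scaleC_scaleC
        comm m1 ac_simps)
    then show ?thesis by (simp only: i0 add_0_right)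
  qed
  then have "(norm u)\<^sup>2 = norm (s *\<^sub>R (1::'a))"
    using cstar_identity[of u] sum by simp
  then have u: "norm u \<le> sqrt s"
    using norm_scaleR_one_le[OF s, where 'a='a] real_le_rsqrt by auto
  have "k = (1/2) *\<^sub>R (u + adj u)"
  proof -
    have "u + adj u = (k + k) + ((- \<i>) *\<^sub>C l + \<i> *\<^sub>C l)"
      unfolding adju unfolding u_def by (simp only: ac_simps)
    then show ?thesis unfolding i0 by (simp only: add_0_right scaleR_half_double)
  qed
  then have "norm k = (1/2) * norm (u + adj u)" by simp
  also have "\<dots> \<le> norm u" using norm_triangle_ineq[of u "adj u"] by simp
  finally have "norm k \<le> sqrt s" using u by simp
  then show ?thesis using s power_mono[of "norm k" "sqrt s" 2]
    by (simp add: norm_square_selfadjoint[OF sa(1)])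
qed

lemma norm_diff_square_le:
  fixes h :: "'a::unital_cstar_algebra"
  assumes sa: "adj h = h" and le: "(norm h)\<^sup>2 \<le> s"
  shows "norm (s *\<^sub>R 1 - h * h) \<le> s"
proof -
  have s: "0 \<le> s" using le by (meson order_trans zero_le_power2)
  have "\<exists>k. positive k \<and> k * k = s *\<^sub>R 1 - h * h \<and> (\<forall>c. c * (s *\<^sub>R 1 - h * h) = (s *\<^sub>R 1 - h * h) * c \<longrightarrow> c * k = k * c)"
    by (rule selfadjoint_sqrt[of _ s])
       (use sa le in \<open>simp_all add: adj_diff adj_scaleR adj_mult norm_square_selfadjoint\<close>)
  then obtain k where k: "positive k" "k * k = s *\<^sub>R 1 - h * h" 
    and comm: "c * (s *\<^sub>R 1 - h * h) = (s *\<^sub>R 1 - h * h) * c \<Longrightarrow> c * k = k * c" for c by blast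
  \<comment> \<open>With \<open>l = h\<close> the two squares add up to
    \<open>s *\<^sub>R 1\<close>, so the bound on \<open>k * k\<close> is the claim itself.\<close>
  have "k * h = h * k" using comm[of h] by (simp add: algebra_simps)
  then have "norm (k * k) \<le> s"
    using k s sa by (intro norm_square_le_if_sum_squares[of k h]) (auto simp: positive_selfadjoint)
  then show ?thesis by (simp add: k)
qed

lemma positive_square: "adj h = h \<Longrightarrow> positive (h * h)"
  unfolding positive_def using norm_diff_square_le[of h] by (auto simp: adj_mult)

lemma positive_one [simp]: "positive 1"
  using positive_square[of 1] by simp

text \<open>The witness \<open>t\<close> in \<open>positive\<close> can be any bound of the norm,
  because a positive element is the square of a selfadjoint one.\<close>

lemma positive_norm_diff: "positive h \<Longrightarrow> norm h \<le> s \<Longrightarrow> norm (s *\<^sub>R 1 - h) \<le> s"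
  by (metis norm_diff_square_le norm_square_selfadjoint positive_selfadjoint positive_sqrt)

lemma positive_scaleR_one_minus:
  fixes h :: "'a::unital_cstar_algebra"
  assumes "adj h = h" "norm h \<le> s"
  shows "positive (s *\<^sub>R 1 - h)"
  unfolding positive_def using assms by (auto simp: adj_diff adj_scaleR intro!: exI[of _ s])

text \<open>The square roots of \<open>h\<close> and \<open>s *\<^sub>R 1 - h\<close> commute and
  their squares add up to \<open>s *\<^sub>R 1\<close>.\<close>

lemma norm_le_if_positive_diff:
  fixes h :: "'a::unital_cstar_algebra"
  assumes h: "positive h" and d: "positive (s *\<^sub>R 1 - h)" and s: "0 \<le> s"
  shows "norm h \<le> s"
proof -
  obtain k where k: "positive k" "k * k = h" "\<And>c. c * h = h * c \<Longrightarrow> c * k = k * c"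
    using positive_sqrt[OF h] by metis
  obtain l where l: "positive l" "l * l = s *\<^sub>R 1 - h"
      "\<And>c. c * (s *\<^sub>R 1 - h) = (s *\<^sub>R 1 - h) * c \<Longrightarrow> c * l = l * c"
    using positive_sqrt[OF d] by metis
  have "k * h = h * k" by (metis k(2) mult.assoc)
  then have "k * l = l * k" by (intro l(3)) (simp add: algebra_simps)
  then have "norm (k * k) \<le> s"
    by (rule norm_square_le_if_sum_squares[OF positive_selfadjoint[OF k(1)] positive_selfadjoint[OF l(1)]])
      (simp_all add: k(2) l(2) s)
  then show ?thesis by (simp add: k(2))
qed

lemma norm_mono_positive:
  assumes "positive a" "positive (b - a)"
  shows "norm a \<le> norm b"
proof (rule norm_le_if_positive_diff)
  have "positive b" using positive_add[OF assms] by simp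
  then have "positive (norm b *\<^sub>R 1 - b)"
    by (intro positive_scaleR_one_minus) (simp_all add: positive_selfadjoint)
  from positive_add[OF this assms(2)] show "positive (norm b *\<^sub>R 1 - a)" by simp
qed (use assms in simp_all)

text \<open>The roots of \<open>a\<close> and \<open>b\<close> commute as well, so their product is
  selfadjoint, and its square is \<open>a * b\<close>.\<close>

lemma positive_mult_commute:
  assumes "positive a" "positive b" "a * b = b * a"
  shows "positive (a * b)"
proof -
  obtain k where k: "positive k" "k * k = a" "\<And>c. c * a = a * c \<Longrightarrow> c * k = k * c"
    using positive_sqrt[OF assms(1)] by metis
  obtain l where l: "positive l" "l * l = b" "\<And>c. c * b = b * c \<Longrightarrow> c * l = l * c"
    using positive_sqrt[OF assms(2)] by metis
  have "b * k = k * b" using assms(3) by (intro k(3)) simp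
  then have kl: "k * l = l * k" by (intro l(3)) simp
  have "positive ((k * l) * (k * l))"
    by (rule positive_square) (simp only: adj_mult positive_selfadjoint[OF k(1)] positive_selfadjoint[OF l(1)] kl)
  also have "(k * l) * (k * l) = a * b"
  proof -
    have "(k * l) * (k * l) = k * (l * k) * l" by (simp only: mult.assoc)
    also have "\<dots> = (k * k) * (l * l)" by (simp only: kl[symmetric] mult.assoc)
    finally show ?thesis by (simp add: k l)
  qed
  finally show ?thesis .
qed

lemma positive_power: "positive a \<Longrightarrow> positive (a ^ n)"
proof (induction n)
  case (Suc n)
  then have "positive (a * a ^ n)"
    by (intro positive_mult_commute) (simp_all only: power_commutes)
  then show ?case by simp
qed simp

section \<open>Positivity of adj x * x and the Cauchy-Schwarz inequality\<close>

text \<open>Up to real factors, \<open>a\<close> and \<open>b\<close> are the real and imaginary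
  parts of \<open>y\<close>; the element in question is half the sum of their squares.\<close>

lemma adj_mult_self_add_mult_adj_self_positive:
  fixes y :: "'a::unital_cstar_algebra"
  shows "positive (adj y * y + y * adj y)"
proof -
  define a where "a = y + adj y"
  define b where "b = \<i> *\<^sub>C (y - adj y)"
  have "adj a = a" by (simp add: a_def adj_add adj_adj add.commute)
  moreover have "adj b = b"
  proof -
    have "adj b = (- \<i>) *\<^sub>C (adj y - y)" by (simp add: b_def adj_scaleC adj_diff adj_adj)
    also have "\<dots> = (- \<i>) *\<^sub>C ((complex_of_real (- 1)) *\<^sub>C (y - adj y))"
      unfolding scaleR_scaleC[symmetric] by simp
    also have "\<dots> = b" unfolding scaleC_scaleC by (simp add: b_def)
    finally show ?thesis .
  qed
  ultimately have "positive ((1/2) *\<^sub>R (a * a + b * b))"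
    by (intro positive_scaleR positive_add positive_square) auto
  also have "b * b = - ((y - adj y) * (y - adj y))"
  proof -
    have "b * b = complex_of_real (- 1) *\<^sub>C ((y - adj y) * (y - adj y))"
      unfolding b_def scaleC_mult_left scaleC_mult_right scaleC_scaleC by simp
    then show ?thesis unfolding scaleR_scaleC[symmetric] by simp
  qed
  also have "a * a + - ((y - adj y) * (y - adj y))
      = (adj y * y + y * adj y) + (adj y * y + y * adj y)"
    unfolding a_def by (simp add: algebra_simps)
  finally show ?thesis by (simp flip: scaleR_right_distrib)
qed

lemma intertwining_power:
  fixes y :: "'a::monoid_mult"
  assumes "a * y = y * b"
  shows "a ^ m * y = y * b ^ m"
proof (induction m)
  case (Suc m)
  have "a ^ Suc m * y = a ^ m * (a * y)" by (simp add: power_Suc2 mult.assoc del: power_Suc)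
  also have "\<dots> = (a ^ m * y) * b" by (simp add: assms mult.assoc)
  also have "\<dots> = y * b ^ Suc m" by (simp add: Suc power_Suc2 mult.assoc del: power_Suc)
  finally show ?case .
qed simp

lemma positive_Bernoulli:
  fixes n :: "'a::unital_cstar_algebra"
  assumes n: "positive n"
  shows "positive ((1 + n) ^ m - 1 - real m *\<^sub>R n)"
proof (induction m)
  case (Suc m)
  define q where "q = (1 + n) ^ m - 1 - real m *\<^sub>R n"
  have "(1 + n) ^ m * n = n * (1 + n) ^ m"
    by (rule power_commuting_commutes) (simp add: algebra_simps)
  then have "q * (1 + n) = (1 + n) * q" by (simp add: q_def algebra_simps)
  then have "positive (q * (1 + n))"
    using Suc n by (intro positive_mult_commute positive_add positive_one) (simp_all add: q_def)
  moreover have "positive (real m *\<^sub>R (n * n))"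
    using n by (intro positive_scaleR positive_square positive_selfadjoint) auto
  ultimately have "positive (q * (1 + n) + real m *\<^sub>R (n * n))" by (rule positive_add)
  also have "q * (1 + n) + real m *\<^sub>R (n * n) = (1 + n) ^ Suc m - 1 - real (Suc m) *\<^sub>R n"
    by (simp add: q_def power_Suc2 scaleR_left_distrib algebra_simps del: power_Suc)
  finally show ?case .
qed simp

text \<open>Bernoulli's inequality is multiplied by \<open>n\<close>; adding \<open>n\<close>
  cancels the term coming from \<open>- 1\<close>.\<close>

lemma norm_mult_Bernoulli:
  fixes n :: "'a::unital_cstar_algebra"
  assumes n: "positive n"
  shows "real m * (norm n)\<^sup>2 \<le> norm (n * (1 + n) ^ m)"
proof -
  define q where "q = (1 + n) ^ m - 1 - real m *\<^sub>R n"
  have nq: "(1 + n) ^ m * n = n * (1 + n) ^ m"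
    by (rule power_commuting_commutes) (simp add: algebra_simps)
  then have "positive (n * q)"
    using n positive_Bernoulli[OF n, of m]
    by (intro positive_mult_commute) (simp_all add: q_def algebra_simps)
  from positive_add[OF this n] have "positive (n * (1 + n) ^ m - real m *\<^sub>R (n * n))"
    by (simp add: q_def algebra_simps)
  moreover have "positive (real m *\<^sub>R (n * n))"
    using n by (intro positive_scaleR positive_square positive_selfadjoint) auto
  ultimately have "norm (real m *\<^sub>R (n * n)) \<le> norm (n * (1 + n) ^ m)"
    by (rule norm_mono_positive[rotated])
  then show ?thesis by (simp add: norm_square_selfadjoint positive_selfadjoint n)
qed

text \<open>For \<open>n = - y\<^sup>* y\<close> positive, \<open>y y\<^sup>*\<close> is positive too, so \<open>1 - y y\<^sup>*\<close> is a contraction, while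
  \<open>(1 - y y\<^sup>*)\<^sup>m y = y (1 + n)\<^sup>m\<close> grows at least linearly in \<open>m\<close> unless \<open>n = 0\<close>.\<close>

lemma negative_adj_mult_self_norm_le_1:
  fixes y :: "'a::unital_cstar_algebra"
  assumes neg: "positive (- (adj y * y))" and le: "norm y \<le> 1"
  shows "y = 0"
proof -
  define n where "n = - (adj y * y)"
  define w where "w = y * adj y"
  \<comment> \<open>\<open>w\<close> is the sum of \<open>adj y * y + y * adj y\<close> and
    \<open>- (adj y * y)\<close>, both positive.\<close>
  have w: "positive w"
    using positive_add[OF adj_mult_self_add_mult_adj_self_positive[of y] neg] by (simp add: w_def)
  have "norm w \<le> 1" using le by (simp add: w_def norm_mult_adj power_le_one)
  from positive_norm_diff[OF w this] have w1: "norm (1 - w) \<le> 1" by simp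
  have bound: "real m * (norm n)\<^sup>2 \<le> 1" for m
  proof -
    have "(1 - w) * y = y * (1 + n)" by (simp add: w_def n_def algebra_simps)
    then have eq: "(1 - w) ^ m * y = y * (1 + n) ^ m" by (rule intertwining_power)
    have "norm ((1 - w) ^ m) \<le> 1"
      by (meson w1 norm_ge_zero norm_power_le order_trans power_le_one)
    then have "norm (y * (1 + n) ^ m) \<le> 1"
      unfolding eq[symmetric] using le by (meson mult_le_one norm_ge_zero norm_mult_ineq order_trans)
    then have "norm (adj y * (y * (1 + n) ^ m)) \<le> 1"
      using le norm_mult_ineq[of "adj y" "y * (1 + n) ^ m"] mult_le_one[of "norm y" "norm (y * (1 + n) ^ m)"]
      by simp
    also have "adj y * (y * (1 + n) ^ m) = - (n * (1 + n) ^ m)" by (simp add: n_def mult.assoc)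
    finally show ?thesis using norm_mult_Bernoulli[of n m] neg by (simp add: n_def)
  qed
  have "(norm n)\<^sup>2 = 0"
  proof (rule ccontr)
    assume "(norm n)\<^sup>2 \<noteq> 0"
    then have "0 < (norm n)\<^sup>2" by simp
    from reals_Archimedean3[OF this] show False using bound by (meson not_le)
  qed
  then show ?thesis by (simp add: n_def cstar_identity)
qed

lemma negative_adj_mult_self:
  fixes y :: "'a::unital_cstar_algebra"
  assumes neg: "positive (- (adj y * y))"
  shows "y = 0"
proof (rule ccontr)
  assume "y \<noteq> 0"
  define z where "z = (1 / norm y) *\<^sub>R y"
  have "- (adj z * z) = ((1 / norm y) * (1 / norm y)) *\<^sub>R (- (adj y * y))"
    by (simp add: z_def adj_scaleR)
  then have "positive (- (adj z * z))" using neg by (simp add: positive_scaleR del: scaleR_minus_right)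
  moreover have "norm z \<le> 1" using \<open>y \<noteq> 0\<close> by (simp add: z_def)
  ultimately have "z = 0" by (rule negative_adj_mult_self_norm_le_1)
  then show False using \<open>y \<noteq> 0\<close> by (simp add: z_def)
qed

text \<open>With \<open>h = x\<^sup>* x\<close>, \<open>k = \<bar>h\<bar>\<close> and \<open>d = k - h\<close>, the identity \<open>h d = - k d\<close> makes \<open>(x d)\<^sup>* (x d)\<close>
  negative. Using \<open>d\<close> itself in place of the negative part of \<open>h\<close> avoids showing that \<open>d\<close> is
  positive.\<close>

lemma positive_adj_mult_self:
  fixes x :: "'a::unital_cstar_algebra"
  shows "positive (adj x * x)"
proof -
  define h where "h = adj x * x"
  have h: "adj h = h" by (simp add: h_def adj_mult adj_adj)
  obtain k where k: "positive k" "k * k = h * h"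
      and kc: "\<And>c. c * (h * h) = (h * h) * c \<Longrightarrow> c * k = k * c"
    using positive_sqrt[OF positive_square[OF h]] by metis
  have hk: "h * k = k * h" by (rule kc) (simp add: mult.assoc)
  define d where "d = k - h"
  have d: "adj d = d" by (simp add: d_def adj_diff h positive_selfadjoint k)
  have dk: "d * k = k * d" by (simp add: d_def algebra_simps hk)
  obtain r where r: "positive r" "r * r = k" and rc: "\<And>c. c * k = k * c \<Longrightarrow> c * r = r * c"
    using positive_sqrt[OF k(1)] by metis
  have dr: "d * r = r * d" by (rule rc[OF dk])
  have hd: "h * d = - (k * d)" by (simp add: d_def algebra_simps hk k(2))
  have "adj (x * d) * (x * d) = d * (h * d)" by (simp add: adj_mult d h_def mult.assoc)
  also have "\<dots> = - (d * (k * d))" by (simp add: hd)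
  finally have y: "adj (x * d) * (x * d) = - (d * (k * d))" .
  \<comment> \<open>Splitting \<open>k = r * r\<close> exhibits this element as the square of the
    selfadjoint \<open>r * d\<close>.\<close>
  have "d * (k * d) = (d * r) * (r * d)" by (simp only: r(2)[symmetric] mult.assoc)
  also have "\<dots> = (r * d) * (r * d)" by (simp only: dr)
  finally have "positive (d * (k * d))"
    using positive_square[of "r * d"] by (simp only: adj_mult d positive_selfadjoint[OF r(1)] dr)
  then have "x * d = 0" by (intro negative_adj_mult_self) (simp add: y)
  then have dkd: "d * (k * d) = 0" using y by simp
  \<comment> \<open>By \<open>hd\<close>, the square of \<open>d\<close> is twice
    \<open>k * d\<close>, so the cube of \<open>d\<close> is twice \<open>d * (k * d) = 0\<close>.
    Applying the C*-identity twice to the vanishing fourth power gives \<open>d = 0\<close>.\<close>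
  have "d * d = k * d + k * d" using hd by (simp add: d_def left_diff_distrib)
  then have "d * (d * d) = 0" by (simp add: distrib_left dkd)
  then have "(d * d) * (d * d) = 0" by (simp add: mult.assoc)
  then have "norm (d * d) = 0"
    using norm_square_selfadjoint[of "d * d"] by (simp add: adj_mult d)
  then have "d = 0" using norm_square_selfadjoint[OF d] by simp
  then show ?thesis using k by (simp add: d_def h_def)
qed

lemma positive_mult_adj_self: "positive (x * adj x)"
  using positive_adj_mult_self[of "adj x"] by (simp add: adj_adj)

lemma positive_conj:
  assumes "positive h"
  shows "positive (adj c * h * c)"
proof -
  obtain k where k: "positive k" "k * k = h" using positive_sqrt[OF assms] by metis
  have "adj (k * c) * (k * c) = adj c * h * c"
    by (simp add: adj_mult positive_selfadjoint[OF k(1)] k(2)[symmetric] mult.assoc)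
  then show ?thesis using positive_adj_mult_self[of "k * c"] by simp
qed

lemma norm_sum_Cauchy_Schwarz:
  fixes x y :: "nat \<Rightarrow> 'a::unital_cstar_algebra"
  shows "(norm (\<Sum>i\<in>F. adj (x i) * y i))\<^sup>2
    \<le> norm (\<Sum>i\<in>F. adj (x i) * x i) * norm (\<Sum>i\<in>F. adj (y i) * y i)"
proof -
  define X where "X = (\<Sum>i\<in>F. adj (x i) * x i)"
  define Y where "Y = (\<Sum>i\<in>F. adj (y i) * y i)"
  define a where "a = (\<Sum>i\<in>F. adj (x i) * y i)"
  have X: "positive X" unfolding X_def by (intro positive_sum positive_adj_mult_self)
  \<comment> \<open>A number strictly above \<open>norm X\<close> is used since the argument divides
    by \<open>t\<close> and \<open>X\<close> may vanish; afterwards \<open>t\<close> is let tend to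
    \<open>norm X\<close>.\<close>
  have "(norm a)\<^sup>2 \<le> t * norm Y" if t: "norm X < t" for t
  proof -
    have t0: "0 < t" using t norm_ge_zero[of X] by linarith
    \<comment> \<open>Expand \<open>\<langle>x a - t y, x a - t y\<rangle> \<ge> 0\<close> for \<open>a = \<langle>x, y\<rangle>\<close> and use \<open>a\<^sup>* \<langle>x, x\<rangle> a \<le> t a\<^sup>* a\<close>.\<close>
    have "positive (\<Sum>i\<in>F. adj (x i * a - t *\<^sub>R y i) * (x i * a - t *\<^sub>R y i))"
      by (intro positive_sum positive_adj_mult_self)
    also have "(\<Sum>i\<in>F. adj (x i * a - t *\<^sub>R y i) * (x i * a - t *\<^sub>R y i))
      = (\<Sum>i\<in>F. adj a * (adj (x i) * x i) * a - t *\<^sub>R (adj a * (adj (x i) * y i))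
          - t *\<^sub>R (adj (adj (x i) * y i) * a) + (t * t) *\<^sub>R (adj (y i) * y i))"
      by (intro sum.cong refl) (simp add: adj_diff adj_mult adj_scaleR adj_adj algebra_simps)
    also have "\<dots> = adj a * X * a - t *\<^sub>R (adj a * a) - t *\<^sub>R (adj a * a) + (t * t) *\<^sub>R Y"
      by (simp only: sum.distrib sum_subtractf X_def Y_def sum_distrib_left[symmetric]
        sum_distrib_right[symmetric] scaleR_sum_right[symmetric] adj_sum[symmetric] a_def[symmetric])
    finally have 1: "positive (adj a * X * a - t *\<^sub>R (adj a * a) - t *\<^sub>R (adj a * a) + (t * t) *\<^sub>R Y)" .
    have 2: "positive (adj a * (t *\<^sub>R 1 - X) * a)"
      using t X by (intro positive_conj positive_scaleR_one_minus) (simp_all add: positive_selfadjoint)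
    have "positive ((1/t) *\<^sub>R ((t * t) *\<^sub>R Y - t *\<^sub>R (adj a * a)))"
      using positive_add[OF 1 2] t0 by (intro positive_scaleR) (simp_all add: algebra_simps)
    then have "positive (t *\<^sub>R Y - adj a * a)"
      using t0 by (simp add: scaleR_right_diff_distrib)
    from norm_mono_positive[OF positive_adj_mult_self this] show ?thesis
      using t0 by (simp add: cstar_identity)
  qed
  then have "(norm a)\<^sup>2 \<le> (norm X + e) * norm Y" if "0 < e" for e
    using that by simp
  then have le: "(norm a)\<^sup>2 \<le> norm X * norm Y + e * norm Y" if "0 < e" for e
    using that by (simp add: distrib_right)
  have "(norm a)\<^sup>2 \<le> norm X * norm Y"
  proof (cases "norm Y = 0")
    case True then show ?thesis using le[of 1] by simp
  next
    case False
    show ?thesis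
    proof (rule field_le_epsilon)
      fix e :: real assume "0 < e"
      then show "(norm a)\<^sup>2 \<le> norm X * norm Y + e" using le[of "e / norm Y"] False by simp
    qed
  qed
  then show ?thesis by (simp add: X_def Y_def a_def)
qed

section \<open>The standard module\<close>

lemma mcarrier_l2: "x \<in> mcarrier l2 \<longleftrightarrow> summable (\<lambda>i. adj (x i) * x i)"
  by (simp add: l2_def)

lemma minner_l2: "minner l2 x y = (\<Sum>i. adj (x i) * y i)"
  by (simp add: l2_def)

lemma maction_l2: "maction l2 x a = (\<lambda>i. x i * a)"
  by (simp add: l2_def)

text \<open>By Cauchy-Schwarz on blocks: those of \<open>x\<close> stay bounded and those of
  \<open>y\<close> tend to \<open>0\<close>. Only boundedness is asked of \<open>x\<close>, which
  need not lie in \<open>l2\<close>; this yields functionals not visibly given by an inner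
  product.\<close>

lemma summable_adj_mult:
  fixes x y :: "nat \<Rightarrow> 'a::unital_cstar_algebra"
  assumes x: "\<And>n. norm (\<Sum>i<n. adj (x i) * x i) \<le> C" and y: "y \<in> mcarrier l2"
  shows "summable (\<lambda>i. adj (x i) * y i)"
    and "norm (\<Sum>i. adj (x i) * y i) \<le> sqrt C * mnorm l2 y"
proof -
  have C: "0 \<le> C" using x[of 0] by simp
  have block: "norm (\<Sum>i=m..<n. adj (x i) * x i) \<le> C" for m n
  proof (cases "m \<le> n")
    case True
    have "(\<Sum>i<n. adj (x i) * x i) = (\<Sum>i<m. adj (x i) * x i) + (\<Sum>i=m..<n. adj (x i) * x i)"
      using True sum.atLeastLessThan_concat[of 0 m n "\<lambda>i. adj (x i) * x i"] by (simp add: atLeast0LessThan)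
    then have "norm (\<Sum>i=m..<n. adj (x i) * x i) \<le> norm (\<Sum>i<n. adj (x i) * x i)"
      by (intro norm_mono_positive) (auto intro!: positive_sum positive_adj_mult_self)
    then show ?thesis using x[of n] by linarith
  qed (simp add: C)
  have sy: "summable (\<lambda>i. adj (y i) * y i)" using y by (simp add: mcarrier_l2)
  show sxy: "summable (\<lambda>i. adj (x i) * y i)"
    unfolding summable_Cauchy
  proof (intro allI impI)
    fix e :: real assume e: "0 < e"
    \<comment> \<open>The denominator is \<open>C + 1\<close> because \<open>C\<close> may be
      \<open>0\<close>.\<close>
    then have "0 < e\<^sup>2 / (C + 1)" using C by simp
    with sy obtain N where N: "\<And>m n. N \<le> m \<Longrightarrow> norm (\<Sum>i=m..<n. adj (y i) * y i) < e\<^sup>2 / (C + 1)"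
      unfolding summable_Cauchy by meson
    have "norm (\<Sum>i=m..<n. adj (x i) * y i) < e" if "N \<le> m" for m n
    proof -
      have "(norm (\<Sum>i=m..<n. adj (x i) * y i))\<^sup>2 \<le> C * norm (\<Sum>i=m..<n. adj (y i) * y i)"
        using norm_sum_Cauchy_Schwarz[of x y "{m..<n}"] block[of m n]
        by (meson mult_right_mono norm_ge_zero order_trans)
      also have "\<dots> \<le> (C + 1) * norm (\<Sum>i=m..<n. adj (y i) * y i)"
        by (simp add: mult_right_mono)
      also have "\<dots> < e\<^sup>2" using N[OF that, of n] C by (simp add: pos_less_divide_eq mult.commute)
      finally show ?thesis by (rule power_less_imp_less_base) (use e in simp)
    qed
    then show "\<exists>N. \<forall>m\<ge>N. \<forall>n. norm (\<Sum>i=m..<n. adj (x i) * y i) < e" by blast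
  qed
  have "(\<lambda>n. (norm (\<Sum>i<n. adj (x i) * y i))\<^sup>2) \<longlonglongrightarrow> (norm (\<Sum>i. adj (x i) * y i))\<^sup>2"
    by (intro tendsto_intros summable_LIMSEQ sxy)
  moreover have "(\<lambda>n. C * norm (\<Sum>i<n. adj (y i) * y i)) \<longlonglongrightarrow> C * norm (\<Sum>i. adj (y i) * y i)"
    by (intro tendsto_intros summable_LIMSEQ sy)
  moreover have "(norm (\<Sum>i<n. adj (x i) * y i))\<^sup>2 \<le> C * norm (\<Sum>i<n. adj (y i) * y i)" for n
    using norm_sum_Cauchy_Schwarz[of x y "{..<n}"] x[of n]
    by (meson mult_right_mono norm_ge_zero order_trans)
  ultimately have "(norm (\<Sum>i. adj (x i) * y i))\<^sup>2 \<le> C * norm (\<Sum>i. adj (y i) * y i)"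
    by (intro LIMSEQ_le[rotated 2]) auto
  then have "norm (\<Sum>i. adj (x i) * y i) \<le> sqrt (C * norm (\<Sum>i. adj (y i) * y i))"
    by (rule real_le_rsqrt)
  then show "norm (\<Sum>i. adj (x i) * y i) \<le> sqrt C * mnorm l2 y"
    by (simp add: mnorm_def minner_l2 real_sqrt_mult)
qed

lemma summable_minner:
  fixes x y :: "nat \<Rightarrow> 'a::unital_cstar_algebra"
  assumes "x \<in> mcarrier l2" "y \<in> mcarrier l2"
  shows "summable (\<lambda>i. adj (x i) * y i)"
proof -
  have "Bseq (\<lambda>n. \<Sum>i<n. adj (x i) * x i)"
    using assms(1) unfolding mcarrier_l2 summable_iff_convergent by (rule convergent_imp_Bseq)
  then obtain C where "\<And>n. norm (\<Sum>i<n. adj (x i) * x i) \<le> C" by (auto simp: Bseq_def)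
  then show ?thesis using assms(2) by (rule summable_adj_mult)
qed

lemma zero_in_l2 [simp]: "0 \<in> mcarrier l2"
  by (simp add: mcarrier_l2)

lemma diff_in_l2:
  fixes x y :: "nat \<Rightarrow> 'a::unital_cstar_algebra"
  assumes "x \<in> mcarrier l2" "y \<in> mcarrier l2"
  shows "x - y \<in> mcarrier l2"
proof -
  have "summable (\<lambda>i. adj (x i) * x i - adj (x i) * y i - (adj (y i) * x i - adj (y i) * y i))"
    using assms by (intro summable_diff summable_minner) auto
  then show ?thesis by (simp add: mcarrier_l2 adj_diff algebra_simps)
qed

lemma finite_support_in_l2:
  assumes "\<And>i. n \<le> i \<Longrightarrow> x i = 0"
  shows "x \<in> mcarrier l2"
  unfolding mcarrier_l2 by (rule summable_finite[of "{..<n}"]) (use assms in \<open>auto simp: not_less\<close>)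

definition l2_unit :: "nat \<Rightarrow> nat \<Rightarrow> 'a::unital_cstar_algebra"
  where "l2_unit i = (\<lambda>j. if j = i then 1 else 0)"

lemma l2_unit_in_l2 [simp]: "l2_unit i \<in> mcarrier l2"
  by (rule finite_support_in_l2[of "Suc i"]) (simp add: l2_unit_def)

lemma suminf_l2_unit: "(\<Sum>j. a j * l2_unit i j) = a i"
proof -
  have "(\<Sum>j. a j * l2_unit i j) = (\<Sum>j\<in>{i}. a j * l2_unit i j)"
    by (rule suminf_finite) (auto simp: l2_unit_def)
  then show ?thesis by (simp add: l2_unit_def)
qed

lemma bounded_coefficients_in_mdual:
  fixes a :: "nat \<Rightarrow> 'a::unital_cstar_algebra"
  assumes a: "\<And>n. norm (\<Sum>i<n. a i * adj (a i)) \<le> C"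
  shows "(\<lambda>x. \<Sum>i. a i * x i) \<in> mdual l2"
proof -
  have *: "summable (\<lambda>i. a i * x i)" "norm (\<Sum>i. a i * x i) \<le> sqrt C * mnorm l2 x"
    if "x \<in> mcarrier l2" for x
    using summable_adj_mult[of "\<lambda>i. adj (a i)" C x] a that by (simp_all add: adj_adj)
  show ?thesis
    unfolding mdual_def
    by (auto simp: maction_l2 distrib_left * suminf_add[symmetric] suminf_mult2 mult.assoc[symmetric]
      intro!: exI[of _ "sqrt C"])
qed

section \<open>Neighbourhoods of zero and coefficients of functionals\<close>

lemma seminorm_topology_nhd_zero:
  fixes S :: "'v::ab_group_add set"
  assumes U: "openin (seminorm_topology S P) U" "0 \<in> U"
    and tri: "\<And>p x y. p \<in> P \<Longrightarrow> x \<in> S \<Longrightarrow> y \<in> S \<Longrightarrow> p (y - x) \<le> p y + p (0 - x)"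
  shows "\<exists>Q d. finite Q \<and> Q \<subseteq> P \<and> 0 < d \<and> (\<forall>y\<in>S. (\<forall>p\<in>Q. p y < d) \<longrightarrow> y \<in> U)"
proof -
  have "generate_topology_on (insert S {{y \<in> S. p (y - x) < e} | p x e. p \<in> P \<and> x \<in> S \<and> e > 0}) U"
    using U(1) by (simp add: seminorm_topology_def openin_topology_generated_by_iff)
  then show ?thesis using U(2)
  proof induction
    case (Int A B)
    then obtain Q d Q' d' where
      "finite Q" "Q \<subseteq> P" "0 < d" "\<forall>y\<in>S. (\<forall>p\<in>Q. p y < d) \<longrightarrow> y \<in> A"
      "finite Q'" "Q' \<subseteq> P" "0 < d'" "\<forall>y\<in>S. (\<forall>p\<in>Q'. p y < d') \<longrightarrow> y \<in> B"
      by blast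
    then show ?case by (intro exI[of _ "Q \<union> Q'"] exI[of _ "min d d'"]) auto
  next
    case (UN K)
    then obtain A where "A \<in> K" "0 \<in> A" by blast
    with UN show ?case by (meson UnionI)
  next
    case (Basis A)
    show ?case
    proof (cases "A = S")
      case True
      then show ?thesis by (intro exI[of _ "{}"] exI[of _ 1]) auto
    next
      case False
      with Basis obtain p x e where A: "A = {y \<in> S. p (y - x) < e}" "p \<in> P" "x \<in> S" by auto
      \<comment> \<open>A ball around \<open>x\<close> that contains \<open>0\<close> also contains
        the ball around \<open>0\<close> whose radius is the slack
        \<open>e - p (0 - x)\<close>.\<close>
      have "p (0 - x) < e" using Basis(2) A by simp
      moreover have "y \<in> A" if "y \<in> S" "p y < e - p (0 - x)" for y
        using tri[OF A(2,3) that(1)] that A by simp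
      ultimately show ?thesis using A(2) by (intro exI[of _ "{p}"] exI[of _ "e - p (0 - x)"]) auto
    qed
  qed simp
qed

lemma mdual_zero: "f \<in> mdual l2 \<Longrightarrow> f 0 = 0"
proof -
  assume "f \<in> mdual l2"
  then have "f (0 + 0) = f 0 + f 0" unfolding mdual_def using zero_in_l2 by blast
  then show ?thesis by simp
qed

lemma mdual_l2_unit_tendsto_zero:
  fixes f :: "(nat \<Rightarrow> 'a::unital_cstar_algebra) \<Rightarrow> 'a"
  assumes eq: "hat_topology (l2 :: (nat \<Rightarrow> 'a, 'a) hmodule) = dual_topology l2"
    and f: "f \<in> mdual l2"
  shows "(\<lambda>i. f (l2_unit i)) \<longlonglongrightarrow> 0"
proof (rule LIMSEQ_I)
  fix r :: real assume r: "0 < r"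
  \<comment> \<open>Writing \<open>y - 0\<close> makes \<open>U\<close> literally a subbasic ball
    around \<open>0\<close>.\<close>
  define U where "U = {y \<in> mcarrier l2. norm (f (y - 0)) < r}"
  have "openin (dual_topology l2) U"
    unfolding dual_topology_def seminorm_topology_def U_def
    by (rule topology_generated_by_Basis, rule insertI2, rule CollectI,
      rule exI[of _ "\<lambda>x. norm (f x)"], rule exI[of _ 0], rule exI[of _ r]) (use f r in auto)
  then have "openin (hat_topology l2) U" by (simp add: eq)
  moreover have "0 \<in> U" using r f by (simp add: U_def mdual_zero)
  ultimately have "\<exists>Q d. finite Q \<and> Q \<subseteq> {\<lambda>x. norm (minner l2 z x) | z. z \<in> mcarrier l2} \<and> 0 < d
      \<and> (\<forall>y\<in>mcarrier l2. (\<forall>p\<in>Q. p y < d) \<longrightarrow> y \<in> U)"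
    unfolding hat_topology_def
  proof (rule seminorm_topology_nhd_zero)
    fix p :: "(nat \<Rightarrow> 'a) \<Rightarrow> real" and x y :: "nat \<Rightarrow> 'a"
    assume "p \<in> {\<lambda>x. norm (minner l2 z x) | z. z \<in> mcarrier l2}" and xy: "x \<in> mcarrier l2" "y \<in> mcarrier l2"
    then obtain z where z: "z \<in> mcarrier l2" "p = (\<lambda>x. norm (minner l2 z x))" by auto
    have "minner l2 z (y - x) = minner l2 z y - minner l2 z x"
      using z xy by (simp add: minner_l2 right_diff_distrib suminf_diff summable_minner)
    moreover have "minner l2 z (0 - x) = - minner l2 z x"
      using z xy by (simp add: minner_l2 suminf_minus summable_minner)
    ultimately show "p (y - x) \<le> p y + p (0 - x)" by (simp add: z norm_triangle_ineq4)
  qed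
  then obtain Q d where Q: "finite Q" "Q \<subseteq> {\<lambda>x. norm (minner l2 z x) | z. z \<in> mcarrier l2}" "0 < d"
      and sub: "\<And>y. y \<in> mcarrier l2 \<Longrightarrow> \<forall>p\<in>Q. p y < d \<Longrightarrow> y \<in> U" by blast
  have "\<forall>\<^sub>F i in sequentially. p (l2_unit i) < d" if "p \<in> Q" for p
  proof -
    obtain z where z: "z \<in> mcarrier l2" "p = (\<lambda>x. norm (minner l2 z x))" using Q(2) \<open>p \<in> Q\<close> by auto
    \<comment> \<open>On the unit vectors \<open>p\<close> takes the values
      \<open>norm (z i)\<close>, whose squares are the norms of the terms of a convergent
      series.\<close>
    have "(\<lambda>i. norm (adj (z i) * z i)) \<longlonglongrightarrow> 0"
      using z(1) unfolding mcarrier_l2 by (intro tendsto_norm_zero summable_LIMSEQ_zero)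
    then have "(\<lambda>i. sqrt ((norm (z i))\<^sup>2)) \<longlonglongrightarrow> sqrt 0"
      unfolding cstar_identity by (rule tendsto_real_sqrt)
    then have "(\<lambda>i. p (l2_unit i)) \<longlonglongrightarrow> 0"
      by (simp add: z minner_l2 suminf_l2_unit)
    then show ?thesis using Q(3) by (rule order_tendstoD)
  qed
  then have "\<forall>\<^sub>F i in sequentially. \<forall>p\<in>Q. p (l2_unit i) < d"
    using Q(1) by (simp add: eventually_ball_finite)
  then have "\<forall>\<^sub>F i in sequentially. norm (f (l2_unit i) - 0) < r"
    by eventually_elim (use sub in \<open>auto simp: U_def\<close>)
  then show "\<exists>no. \<forall>n\<ge>no. norm (f (l2_unit n) - 0) < r" by (simp add: eventually_sequentially)
qed

text \<open>A property of the algebra alone, through which both conclusions are derived. Decreasing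
  sequences are treated by passing to negatives.\<close>

definition bounded_monotone_convergent :: "'a::unital_cstar_algebra itself \<Rightarrow> bool"
  where "bounded_monotone_convergent _ \<longleftrightarrow>
    (\<forall>s :: nat \<Rightarrow> 'a. (\<forall>n. positive (s (Suc n) - s n)) \<longrightarrow> Bseq s \<longrightarrow> convergent s)"

lemma bounded_monotone_convergent_if_topologies_eq:
  assumes eq: "hat_topology (l2 :: (nat \<Rightarrow> 'a::unital_cstar_algebra, 'a) hmodule) = dual_topology l2"
  shows "bounded_monotone_convergent TYPE('a)"
  unfolding bounded_monotone_convergent_def
proof (intro allI impI)
  fix s :: "nat \<Rightarrow> 'a"
  assume inc: "\<forall>n. positive (s (Suc n) - s n)" and "Bseq s"
  then obtain C where C: "\<And>n. norm (s n) \<le> C" by (auto simp: Bseq_def)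
  have mono: "positive (s n - s m)" if "m \<le> n" for m n
    using that
  proof (induction n rule: dec_induct)
    case (step n)
    from positive_add[OF step.IH inc[rule_format, of n]] show ?case by simp
  qed simp
  show "convergent s"
  proof (rule Cauchy_convergent, rule ccontr)
    assume "\<not> Cauchy s"
    then obtain e where e: "0 < e" and "\<forall>N. \<exists>n\<ge>N. e \<le> norm (s n - s N)"
      unfolding Cauchy_altdef2 dist_norm by (meson not_le)
    then obtain g where g: "\<And>N. N \<le> g N" "\<And>N. e \<le> norm (s (g N) - s N)" by metis
    \<comment> \<open>Iterating \<open>g\<close> makes the blocks consecutive: each increment
      \<open>d k\<close> has norm at least \<open>e\<close>, yet the increments telescope and their
      sums stay within \<open>C + C\<close>.\<close>
    define r where "r k = (g ^^ k) 0" for k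
    have r: "r (Suc k) = g (r k)" "r 0 = 0" for k by (simp_all add: r_def)
    define d where "d k = s (r (Suc k)) - s (r k)" for k
    \<comment> \<open>The roots \<open>b k\<close> are the coefficients of a functional, so they
      tend to \<open>0\<close>, contradicting the lower bound on \<open>d k\<close>.\<close>
    have "\<exists>b. positive b \<and> b * b = d k" for k
      using positive_sqrt[of "d k"] mono[OF g(1)] unfolding d_def r by metis
    then obtain b where b: "\<And>k. positive (b k)" "\<And>k. b k * b k = d k" by metis
    have sum_b: "(\<Sum>k<n. b k * adj (b k)) = s (r n) - s 0" for n
      using sum_lessThan_telescope[of "\<lambda>k. s (r k)" n]
      by (simp add: positive_selfadjoint b d_def r(2))
    have "norm (\<Sum>k<n. b k * adj (b k)) \<le> C + C" for n
      unfolding sum_b by (meson C add_mono norm_triangle_ineq4 order_trans)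
    then have "(\<lambda>x. \<Sum>i. b i * x i) \<in> mdual l2" by (rule bounded_coefficients_in_mdual)
    from mdual_l2_unit_tendsto_zero[OF eq this] have "b \<longlonglongrightarrow> 0" by (simp add: suminf_l2_unit)
    then have "(\<lambda>k. b k * b k) \<longlonglongrightarrow> 0 * 0" by (intro tendsto_mult)
    then have "(\<lambda>k. norm (d k)) \<longlonglongrightarrow> 0" by (simp add: b tendsto_norm_zero)
    then have "e \<le> 0" by (rule LIMSEQ_le_const) (auto simp: d_def r g)
    then show False using e by simp
  qed
qed

section \<open>Self-duality\<close>

lemma mdual_l2_truncate:
  fixes f :: "(nat \<Rightarrow> 'a::unital_cstar_algebra) \<Rightarrow> 'a"
  assumes f: "f \<in> mdual l2"
  shows "f (\<lambda>i. if i < n then x i else 0) = (\<Sum>i<n. f (l2_unit i) * x i)"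
proof (induction n)
  case 0
  have "(\<lambda>i. if i < 0 then x i else 0) = 0" by (simp add: fun_eq_iff)
  then show ?case using mdual_zero[OF f] by simp
next
  case (Suc n)
  have "(\<lambda>i. if i < Suc n then x i else 0)
      = (\<lambda>i. if i < n then x i else 0) + maction l2 (l2_unit n) (x n)"
    by (auto simp: fun_eq_iff maction_l2 l2_unit_def less_Suc_eq)
  moreover have "f ((\<lambda>i. if i < n then x i else 0) + maction l2 (l2_unit n) (x n))
      = f (\<lambda>i. if i < n then x i else 0) + f (maction l2 (l2_unit n) (x n))"
  proof -
    have "(\<lambda>i. if i < n then x i else 0) \<in> mcarrier l2" by (rule finite_support_in_l2[of n]) simp
    moreover have "maction l2 (l2_unit n) (x n) \<in> mcarrier l2"
      by (rule finite_support_in_l2[of "Suc n"]) (simp add: maction_l2 l2_unit_def)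
    ultimately show ?thesis using f unfolding mdual_def by blast
  qed
  moreover have "f (maction l2 (l2_unit n) (x n)) = f (l2_unit n) * x n"
    using f l2_unit_in_l2 unfolding mdual_def by blast
  ultimately show ?case using Suc by simp
qed

lemma self_dual_if_bounded_monotone_convergent:
  assumes mc: "bounded_monotone_convergent TYPE('a::unital_cstar_algebra)"
  shows "self_dual (l2 :: (nat \<Rightarrow> 'a, 'a) hmodule)"
  unfolding self_dual_def
proof
  fix f :: "(nat \<Rightarrow> 'a) \<Rightarrow> 'a" assume f: "f \<in> mdual l2"
  then obtain C where C: "\<And>x. x \<in> mcarrier l2 \<Longrightarrow> norm (f x) \<le> C * mnorm l2 x"
    unfolding mdual_def by blast
  define z where "z i = adj (f (l2_unit i))" for i
  define S where "S n = (\<Sum>i<n. f (l2_unit i) * adj (f (l2_unit i)))" for n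
  have "norm (S n) \<le> C\<^sup>2" for n
  proof (cases "S n = 0")
    case False
    \<comment> \<open>Testing \<open>f\<close> on the truncation of \<open>z\<close> gives
      \<open>S n\<close>, while the squared norm of that truncation is \<open>norm (S n)\<close>;
      cancelling one factor \<open>sqrt (norm (S n))\<close> bounds it by \<open>C\<close>.\<close>
    let ?t = "\<lambda>i. if i < n then z i else 0"
    have "minner l2 ?t ?t = (\<Sum>i<n. adj (?t i) * ?t i)"
      unfolding minner_l2 by (rule suminf_finite) auto
    also have "\<dots> = S n" unfolding S_def by (intro sum.cong) (auto simp: z_def adj_adj)
    finally have "mnorm l2 ?t = sqrt (norm (S n))" by (simp add: mnorm_def)
    moreover have "f ?t = S n" unfolding mdual_l2_truncate[OF f] by (simp add: S_def z_def)
    moreover have "?t \<in> mcarrier l2" by (rule finite_support_in_l2[of n]) simp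
    ultimately have "norm (S n) \<le> C * sqrt (norm (S n))" using C[of ?t] by simp
    moreover have "norm (S n) = sqrt (norm (S n)) * sqrt (norm (S n))" by simp
    ultimately have "sqrt (norm (S n)) * sqrt (norm (S n)) \<le> C * sqrt (norm (S n))" by linarith
    then have "sqrt (norm (S n)) \<le> C" using False by (subst (asm) mult_le_cancel_right_pos) auto
    then show ?thesis by (rule sqrt_le_D)
  qed simp
  then have "Bseq S" by (rule BseqI')
  moreover have "positive (S (Suc n) - S n)" for n
    by (simp add: S_def positive_mult_adj_self)
  ultimately have "convergent S" using mc unfolding bounded_monotone_convergent_def by blast
  then have z: "z \<in> mcarrier l2"
    by (simp add: mcarrier_l2 summable_iff_convergent z_def adj_adj S_def[abs_def])
  \<comment> \<open>Both sides agree on truncations of \<open>y\<close>, and these converge to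
    \<open>y\<close> in the module norm, for which \<open>f\<close> is continuous.\<close>
  have "f y = minner l2 z y" if y: "y \<in> mcarrier l2" for y
  proof -
    define t where "t n = (\<lambda>i. if i < n then y i else 0)" for n
    have t: "t n \<in> mcarrier l2" for n by (rule finite_support_in_l2[of n]) (simp add: t_def)
    have sy: "summable (\<lambda>i. adj (y i) * y i)" using y by (simp add: mcarrier_l2)
    have "mnorm l2 (y - t n) = sqrt (norm ((\<Sum>i. adj (y i) * y i) - (\<Sum>i<n. adj (y i) * y i)))" for n
    proof -
      have "(\<Sum>i<n. adj (y i) * y i) = (\<Sum>i. adj (t n i) * t n i)"
        by (subst suminf_finite[of "{..<n}"]) (auto simp: t_def)
      moreover have "(\<Sum>i. adj (y i) * y i) - (\<Sum>i. adj (t n i) * t n i)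
          = (\<Sum>i. adj (y i) * y i - adj (t n i) * t n i)"
        using sy t[of n] by (intro suminf_diff) (simp_all add: mcarrier_l2)
      moreover have "(\<lambda>i. adj (y i) * y i - adj (t n i) * t n i) = (\<lambda>i. adj ((y - t n) i) * (y - t n) i)"
        by (auto simp: fun_eq_iff t_def)
      ultimately show ?thesis by (simp add: mnorm_def minner_l2)
    qed
    moreover have "(\<lambda>n. sqrt (norm ((\<Sum>i. adj (y i) * y i) - (\<Sum>i<n. adj (y i) * y i))))
        \<longlonglongrightarrow> sqrt (norm ((\<Sum>i. adj (y i) * y i) - (\<Sum>i. adj (y i) * y i)))"
      by (intro tendsto_intros summable_LIMSEQ sy)
    ultimately have "(\<lambda>n. mnorm l2 (y - t n)) \<longlonglongrightarrow> 0" by simp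
    then have lim: "(\<lambda>n. C * mnorm l2 (y - t n)) \<longlonglongrightarrow> 0" by (rule tendsto_mult_right_zero)
    have "norm (f (y - t n)) \<le> C * mnorm l2 (y - t n)" for n by (intro C diff_in_l2 y t)
    then have "(\<lambda>n. f (y - t n)) \<longlonglongrightarrow> 0"
      by (intro Lim_null_comparison[OF _ lim] always_eventually allI)
    moreover have "f (y - t n) = f y - (\<Sum>i<n. adj (z i) * y i)" for n
    proof -
      have "f ((y - t n) + t n) = f (y - t n) + f (t n)"
        using f diff_in_l2[OF y t[of n]] t[of n] unfolding mdual_def by blast
      moreover have "f (t n) = (\<Sum>i<n. adj (z i) * y i)"
        unfolding t_def mdual_l2_truncate[OF f] by (simp add: z_def adj_adj)
      ultimately show ?thesis by simp
    qed
    ultimately have "(\<lambda>n. f y - (f y - (\<Sum>i<n. adj (z i) * y i))) \<longlonglongrightarrow> f y - 0"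
      by (intro tendsto_diff tendsto_const) simp
    then have "(\<lambda>i. adj (z i) * y i) sums f y" by (simp add: sums_def)
    then show ?thesis by (simp add: minner_l2 sums_unique)
  qed
  then show "\<exists>x\<in>mcarrier l2. \<forall>y\<in>mcarrier l2. f y = minner l2 x y" using z by blast
qed

section \<open>Projections and finite dimension\<close>

definition projection :: "'a::unital_cstar_algebra \<Rightarrow> bool"
  where "projection p \<longleftrightarrow> adj p = p \<and> p * p = p"

text \<open>The equation \<open>p * q = q\<close> says that the projection \<open>q\<close> lies
  below \<open>p\<close>.\<close>

definition minimal_projection :: "'a::unital_cstar_algebra \<Rightarrow> bool"
  where "minimal_projection p \<longleftrightarrow>
    projection p \<and> p \<noteq> 0 \<and> (\<forall>q. projection q \<longrightarrow> p * q = q \<longrightarrow> q = 0 \<or> q = p)"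

lemma norm_projection: "projection p \<Longrightarrow> p \<noteq> 0 \<Longrightarrow> norm p = 1"
  using norm_square_selfadjoint[of p] by (simp add: projection_def power2_eq_square)

lemma projection_diff:
  assumes p: "projection p" and q: "projection q" and pq: "p * q = q"
  shows "projection (p - q)"
proof -
  have "adj (p * q) = adj q" by (simp add: pq)
  then have "q * p = q" using p q by (simp add: adj_mult projection_def)
  then show ?thesis using p q pq by (simp add: projection_def adj_diff algebra_simps)
qed

section \<open>Corners at minimal projections\<close>

lemma norm_power_of_two_selfadjoint:
  fixes a :: "'a::unital_cstar_algebra"
  assumes "adj a = a" "norm a = 1"
  shows "norm (a ^ 2 ^ k) = 1"
proof (induction k)
  case 0 then show ?case by (simp add: assms)
next
  case (Suc k)
  have "a ^ 2 ^ Suc k = a ^ 2 ^ k * a ^ 2 ^ k" by (simp add: mult_2 power_add)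
  then show ?case using Suc by (simp add: norm_square_selfadjoint adj_power assms)
qed

text \<open>The powers of \<open>a\<close> decrease to a nonzero projection \<open>q\<close> below
  \<open>p\<close>, so \<open>q = p\<close> by minimality; then \<open>a * q = q\<close> turns into
  \<open>a = p\<close>.\<close>

lemma minimal_projection_corner_positive:
  fixes a p :: "'a::unital_cstar_algebra"
  assumes mc: "bounded_monotone_convergent TYPE('a)" and p: "minimal_projection p"
    and a: "positive a" "norm a = 1" "p * a = a" "a * p = a"
  shows "a = p"
proof -
  have sa: "adj a = a" using a by (simp add: positive_selfadjoint)
  have "positive (- (a ^ Suc n) - - (a ^ n))" for n
  proof -
    have "positive (a ^ n * (1 - a))"
      using positive_scaleR_one_minus[OF sa, of 1] a
      by (intro positive_mult_commute positive_power) (simp_all add: algebra_simps power_commutes)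
    then show ?thesis by (simp add: algebra_simps power_commutes)
  qed
  moreover have "Bseq (\<lambda>n. - (a ^ n))"
    by (rule BseqI'[where K = 1]) (use norm_power_le[of a] a in simp)
  ultimately have "convergent (\<lambda>n. - (a ^ n))"
    using mc[unfolded bounded_monotone_convergent_def, rule_format, of "\<lambda>n. - (a ^ n)"] by blast
  then obtain q where q: "(\<lambda>n. a ^ n) \<longlonglongrightarrow> q"
    unfolding convergent_minus_iff[symmetric] convergent_def by blast
  have sub: "(\<lambda>n. a ^ r n) \<longlonglongrightarrow> q" if "strict_mono r" for r
    using LIMSEQ_subseq_LIMSEQ[OF q that] by (simp add: o_def)
  have "(\<lambda>n. a ^ (n + n)) \<longlonglongrightarrow> q * q"
    unfolding power_add by (intro tendsto_mult q)
  moreover have "(\<lambda>n. a ^ (n + n)) \<longlonglongrightarrow> q"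
    by (rule sub) (simp add: strict_mono_def)
  ultimately have "q * q = q" by (rule LIMSEQ_unique)
  moreover have "adj q = q"
  proof (rule LIMSEQ_unique)
    show "(\<lambda>n. adj (a ^ n)) \<longlonglongrightarrow> adj q" by (rule bounded_linear.tendsto[OF bounded_linear_adj q])
    show "(\<lambda>n. adj (a ^ n)) \<longlonglongrightarrow> q" using q by (simp add: adj_power sa)
  qed
  ultimately have "projection q" by (simp add: projection_def)
  have qS: "(\<lambda>n. a ^ Suc n) \<longlonglongrightarrow> q" by (rule sub) (simp add: strict_mono_def)
  have aq: "a * q = q"
  proof (rule LIMSEQ_unique)
    show "(\<lambda>n. a * a ^ n) \<longlonglongrightarrow> a * q" by (intro tendsto_mult q tendsto_const)
    show "(\<lambda>n. a * a ^ n) \<longlonglongrightarrow> q" using qS by simp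
  qed
  have "p * q = q" by (metis aq a(3) mult.assoc)
  \<comment> \<open>The C*-identity controls the norms along the exponents \<open>2 ^ n\<close>,
    which is enough to keep the limit away from \<open>0\<close>.\<close>
  moreover have "norm q = 1"
  proof (rule LIMSEQ_unique)
    show "(\<lambda>n. norm (a ^ 2 ^ n)) \<longlonglongrightarrow> norm q"
      by (intro tendsto_norm sub) (simp add: strict_mono_def)
    show "(\<lambda>n. norm (a ^ 2 ^ n)) \<longlonglongrightarrow> 1"
      by (simp add: norm_power_of_two_selfadjoint sa a)
  qed
  ultimately have "q = p" using p \<open>projection q\<close> unfolding minimal_projection_def by fastforce
  then show ?thesis using aq a by simp
qed

lemma minimal_projection_corner:
  fixes a p :: "'a::unital_cstar_algebra"
  assumes mc: "bounded_monotone_convergent TYPE('a)" and p: "minimal_projection p"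
    and a: "p * a = a" "a * p = a"
  shows "\<exists>c. a = c *\<^sub>C p"
proof -
  have pp: "p * p = p" "adj p = p" using p by (auto simp: minimal_projection_def projection_def)
  have pos: "\<exists>r. h = r *\<^sub>R p" if h: "positive h" "p * h = h" "h * p = h" for h
  proof (cases "h = 0")
    case True then show ?thesis by (intro exI[of _ 0]) simp
  next
    case False
    have "(1 / norm h) *\<^sub>R h = p"
      using False h by (intro minimal_projection_corner_positive[OF mc p] positive_scaleR) simp_all
    then have "norm h *\<^sub>R p = h" using False by (metis nonzero_eq_divide_eq norm_eq_zero scaleR_one scaleR_scaleR mult.commute)
    then show ?thesis by metis
  qed
  have sa: "\<exists>r. h = r *\<^sub>R p" if h: "adj h = h" "p * h = h" "h * p = h" for h
  proof -
    \<comment> \<open>Compressing by \<open>p\<close> moves the positive element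
      \<open>norm h *\<^sub>R 1 - h\<close> into the corner, where \<open>pos\<close>
      applies.\<close>
    have "positive (adj p * (norm h *\<^sub>R 1 - h) * p)"
      using h by (intro positive_conj positive_scaleR_one_minus) auto
    also have "adj p * (norm h *\<^sub>R 1 - h) * p = norm h *\<^sub>R p - h"
      using h pp by (simp add: algebra_simps)
    finally have "\<exists>r. norm h *\<^sub>R p - h = r *\<^sub>R p"
      using h pp by (intro pos) (simp_all add: algebra_simps)
    then obtain r where "norm h *\<^sub>R p - h = r *\<^sub>R p" ..
    then have "h = (norm h - r) *\<^sub>R p" by (simp add: algebra_simps)
    then show ?thesis ..
  qed
  have adja: "p * adj a = adj a" "adj a * p = adj a"
    using arg_cong[OF a(2), of adj] arg_cong[OF a(1), of adj] pp by (simp_all add: adj_mult)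
  have 1: "\<exists>r. a + adj a = r *\<^sub>R p"
    using a adja by (intro sa) (simp_all add: adj_add adj_adj add.commute algebra_simps)
  have "\<exists>r. \<i> *\<^sub>C (a - adj a) = r *\<^sub>R p"
  proof (rule sa)
    have "adj (\<i> *\<^sub>C (a - adj a)) = (- \<i>) *\<^sub>C (complex_of_real (- 1) *\<^sub>C (a - adj a))"
      unfolding scaleR_scaleC[symmetric] by (simp add: adj_scaleC adj_diff adj_adj)
    then show "adj (\<i> *\<^sub>C (a - adj a)) = \<i> *\<^sub>C (a - adj a)" unfolding scaleC_scaleC by simp
  qed (use a adja in \<open>simp_all add: scaleC_mult_left scaleC_mult_right algebra_simps\<close>)
  \<comment> \<open>An arbitrary \<open>a\<close> is recovered from its selfadjoint combinations
    \<open>a + adj a\<close> and \<open>\<i> *\<^sub>C (a - adj a)\<close>, both real multiples of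
    \<open>p\<close>.\<close>
  then obtain r s where rs: "a + adj a = r *\<^sub>R p" "\<i> *\<^sub>C (a - adj a) = s *\<^sub>R p" using 1 by blast
  have "a - adj a = (- \<i>) *\<^sub>C (\<i> *\<^sub>C (a - adj a))"
    using scaleR_scaleC[of 1 "a - adj a"] by (simp add: scaleC_scaleC)
  then have "a - adj a = (- \<i> * of_real s) *\<^sub>C p" by (simp only: rs scaleR_scaleC scaleC_scaleC)
  moreover have "a + adj a = of_real r *\<^sub>C p" by (simp only: rs scaleR_scaleC)
  ultimately have "(a + adj a) + (a - adj a) = (of_real r + - \<i> * of_real s) *\<^sub>C p"
    by (simp only: scaleC_add_left)
  then have "(1/2) *\<^sub>R (a + a) = (1/2) *\<^sub>R ((of_real r + - \<i> * of_real s) *\<^sub>C p)" by simp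
  then have "a = (complex_of_real (1/2) * (of_real r + - \<i> * of_real s)) *\<^sub>C p"
    by (simp only: scaleR_half_double) (simp only: scaleR_scaleC scaleC_scaleC)
  then show ?thesis ..
qed

text \<open>Any nonzero \<open>x\<close> in the corner spans it:
  \<open>x * adj x = m *\<^sub>C p\<close> with \<open>m\<close> nonzero and
  \<open>adj x * y = c *\<^sub>C q\<close>, so evaluating \<open>x * adj x * y\<close> in two ways
  gives \<open>m *\<^sub>C y = c *\<^sub>C x\<close>.\<close>

lemma minimal_projections_corner:
  fixes p q :: "'a::unital_cstar_algebra"
  assumes mc: "bounded_monotone_convergent TYPE('a)"
    and p: "minimal_projection p" and q: "minimal_projection q"
  shows "\<exists>x. \<forall>a. \<exists>c. p * a * q = c *\<^sub>C x"
proof (cases "\<forall>a. p * a * q = 0")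
  case True
  then show ?thesis using scaleR_scaleC[of 0 "0::'a"] by (metis scaleR_zero_left)
next
  case False
  have pp: "p * p = p" "adj p = p" "q * q = q" "adj q = q"
    using p q by (auto simp: minimal_projection_def projection_def)
  obtain x where x: "x \<noteq> 0" "p * x = x" "x * q = x"
    using False pp by (metis mult.assoc)
  have adjx: "adj x * p = adj x" "q * adj x = adj x"
    using arg_cong[OF x(2), of adj] arg_cong[OF x(3), of adj] pp by (simp_all add: adj_mult)
  obtain m where m: "x * adj x = m *\<^sub>C p"
    using minimal_projection_corner[OF mc p, of "x * adj x"] x adjx by (metis mult.assoc)
  have m0: "m \<noteq> 0"
  proof
    assume "m = 0"
    then have "x * adj x = 0" using m scaleR_scaleC[of 0 p] by simp
    then show False using norm_mult_adj[of x] x by simp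
  qed
  have "\<exists>c. p * a * q = c *\<^sub>C x" for a
  proof -
    define y where "y = p * a * q"
    have y: "p * y = y" "y * q = y" using pp by (simp_all add: y_def mult.assoc) (metis mult.assoc)
    obtain c where c: "adj x * y = c *\<^sub>C q"
      using minimal_projection_corner[OF mc q, of "adj x * y"] y adjx by (metis mult.assoc)
    have "m *\<^sub>C y = (x * adj x) * y" by (simp add: m scaleC_mult_left y)
    also have "\<dots> = c *\<^sub>C x" by (simp add: mult.assoc c scaleC_mult_right x)
    finally have "(1 / m) *\<^sub>C (m *\<^sub>C y) = (1 / m) *\<^sub>C (c *\<^sub>C x)" by simp
    then have "y = (1 / m * c) *\<^sub>C x"
      using m0 scaleR_scaleC[of 1 y] by (simp add: scaleC_scaleC)
    then show ?thesis unfolding y_def ..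
  qed
  then show ?thesis by blast
qed

section \<open>Splitting the identity into minimal projections\<close>

lemma wf_projections:
  assumes mc: "bounded_monotone_convergent TYPE('a::unital_cstar_algebra)"
  shows "wf {(q, p :: 'a). projection q \<and> projection p \<and> p * q = q \<and> q \<noteq> p}"
  unfolding wf_iff_no_infinite_down_chain
proof
  assume "\<exists>f. \<forall>i. (f (Suc i), f i) \<in> {(q, p :: 'a). projection q \<and> projection p \<and> p * q = q \<and> q \<noteq> p}"
  then obtain f :: "nat \<Rightarrow> 'a" where f: "\<And>i. projection (f i)" "\<And>i. f i * f (Suc i) = f (Suc i)"
      "\<And>i. f (Suc i) \<noteq> f i" by auto
  have d: "projection (f i - f (Suc i))" for i by (rule projection_diff) (auto simp: f)
  have "positive (- f (Suc i) - - f i)" for i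
    using positive_square[of "f i - f (Suc i)"] d[of i] by (simp add: projection_def)
  moreover have "Bseq (\<lambda>i. - f i)"
    by (rule BseqI'[where K = 1]) (use norm_projection[OF f(1)] in \<open>metis norm_minus_cancel norm_zero order_refl zero_le_one\<close>)
  ultimately have "convergent (\<lambda>i. - f i)"
    using mc[unfolded bounded_monotone_convergent_def, rule_format, of "\<lambda>i. - f i"] by blast
  then obtain l where l: "f \<longlonglongrightarrow> l" unfolding convergent_minus_iff[symmetric] convergent_def by blast
  \<comment> \<open>Convergence forces consecutive differences to \<open>0\<close>, but they are
    nonzero projections and so have norm \<open>1\<close>.\<close>
  have "(\<lambda>i. norm (f i - f (Suc i))) \<longlonglongrightarrow> norm (l - l)"
    by (intro tendsto_norm tendsto_diff l LIMSEQ_Suc)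
  moreover have "norm (f i - f (Suc i)) = 1" for i using norm_projection[OF d] f(3)[of i] by simp
  ultimately show False by (simp add: LIMSEQ_const_iff)
qed

text \<open>Well-founded induction: a nonzero projection that is not minimal splits as
  \<open>(p - q) + q\<close> with both summands strictly below it. With a list, repeated summands
  need no attention.\<close>

lemma projection_sum_minimal:
  fixes p :: "'a::unital_cstar_algebra"
  assumes mc: "bounded_monotone_convergent TYPE('a)"
  shows "projection p \<Longrightarrow> \<exists>ps. (\<forall>q\<in>set ps. minimal_projection q) \<and> sum_list ps = p"
proof (induction p rule: wf_induct_rule[OF wf_projections[OF mc]])
  case (1 p)
  consider "p = 0" | "minimal_projection p"
    | q where "projection q" "p * q = q" "q \<noteq> 0" "q \<noteq> p"
    using 1(2) unfolding minimal_projection_def by blast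
  then show ?case
  proof cases
    case 1 then show ?thesis by (intro exI[of _ "[]"]) simp
  next
    case 2 then show ?thesis by (intro exI[of _ "[p]"]) simp
  next
    case q: 3
    have d: "projection (p - q)" using 1(2) q by (intro projection_diff)
    have "p * (p - q) = p - q" using 1(2) q by (simp add: projection_def algebra_simps)
    then obtain ps where "\<forall>q\<in>set ps. minimal_projection q" "sum_list ps = p - q"
      using 1(1)[of "p - q"] 1(2) d q by auto
    moreover obtain qs where "\<forall>q\<in>set qs. minimal_projection q" "sum_list qs = q"
      using 1(1)[of q] 1(2) q by auto
    ultimately show ?thesis by (intro exI[of _ "ps @ qs"]) auto
  qed
qed

lemma finite_dim_if_bounded_monotone_convergent:
  assumes mc: "bounded_monotone_convergent TYPE('a::unital_cstar_algebra)"
  shows "finite_dim_over_complex TYPE('a)"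
proof -
  interpret vs: vector_space "scaleC :: complex \<Rightarrow> 'a \<Rightarrow> 'a" by (rule vector_space_scaleC)
  obtain ps :: "'a list" where ps: "\<forall>p\<in>set ps. minimal_projection p" "sum_list ps = 1"
    using projection_sum_minimal[OF mc, of 1] by (auto simp: projection_def)
  have "\<forall>p q. \<exists>x. p \<in> set ps \<longrightarrow> q \<in> set ps \<longrightarrow> (\<forall>a. \<exists>c. p * a * q = c *\<^sub>C x)"
    using minimal_projections_corner[OF mc] ps(1) by blast
  then obtain x where x: "\<And>p q a. p \<in> set ps \<Longrightarrow> q \<in> set ps \<Longrightarrow> \<exists>c. p * a * q = c *\<^sub>C x p q" by metis
  define M where "M = (\<lambda>(p, q). x p q) ` (set ps \<times> set ps)"
  have M: "finite M" by (simp add: M_def)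
  have corner: "p * a * q \<in> vs.span M" if "p \<in> set ps" "q \<in> set ps" for p q a
  proof -
    have "x p q \<in> M" using that by (auto simp: M_def)
    then show ?thesis using x[OF that, of a] by (metis vs.span_base vs.span_scale)
  qed
  have "sum_list qs * a * sum_list rs \<in> vs.span M" if "set qs \<subseteq> set ps" "set rs \<subseteq> set ps" for qs rs a
    using that(1)
  proof (induction qs)
    case (Cons q qs)
    have "q * a * sum_list rs \<in> vs.span M"
      using that(2) by (induction rs) (use Cons.prems in \<open>auto simp: distrib_left intro!: vs.span_zero vs.span_add corner\<close>)
    then show ?case using Cons by (simp add: distrib_right vs.span_add)
  qed (simp add: vs.span_zero)
  \<comment> \<open>Both sums equal \<open>1\<close>, so the product is \<open>a\<close>
    itself.\<close>
  from this[of ps ps] have "a \<in> vs.span M" for a by (simp add: ps)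
  then have span: "vs.span M = UNIV" by blast
  obtain B where B: "B \<subseteq> M" "vs.independent B" "M \<subseteq> vs.span B"
    using vs.maximal_independent_subset by blast
  have "vs.span B = UNIV" using vs.span_minimal[OF B(3) vs.subspace_span] span by auto
  then have "finite_dimensional_vector_space (scaleC :: complex \<Rightarrow> 'a \<Rightarrow> 'a) B"
    using B M by unfold_locales (auto intro: finite_subset)
  then show ?thesis unfolding finite_dim_over_complex_def ..
qed

theorem theorem3p7:
  assumes "hat_topology (l2 :: (nat \<Rightarrow> 'a, 'a::unital_cstar_algebra) hmodule) = dual_topology l2"
  shows "self_dual (l2 :: (nat \<Rightarrow> 'a, 'a) hmodule) \<and> finite_dim_over_complex TYPE('a)"
  using bounded_monotone_convergent_if_topologies_eq[OF assms]
    self_dual_if_bounded_monotone_convergent finite_dim_if_bounded_monotone_convergent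
  by blast

end
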